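(* Let $(X,\varphi)$ be an irreducible Smale space, let $P,Q\subset X$ be periodic orbits with $P\cap Q=\varnothing$, and let $(\mathcal R_n^\delta)_{n\ge0}$ be a refining sequence of $\delta$-enlarged Markov partitions of $X$, with $\mathcal R^\delta=\coprod_{n\ge0}\mathcal R_n^\delta$. Then $(X,\varphi)$ has an aperiodic $\mathcal R^\delta$-sample $\mathcal G\subseteq X^h(P,Q)$; that is, there is an injective function $c:\mathcal R^\delta\to X$ with $c(R^\delta)\in R^\delta$ for all $R^\delta\in\mathcal R^\delta$, whose image $\mathcal G=c(\mathcal R^\delta)$ is contained in $X^h(P,Q)$ and satisfies $\varphi^j(\mathcal G)\cap\mathcal G=\varnothing$ for all $j\in\mathbb Z\setminus\{0\}$.
   Context: A Smale space $(X,\varphi)$ consists of an infinite compact metric space $(X,d)$, a homeomorphism $\varphi:X\to X$, constants $\varepsilon_X>0$, $\lambda>1$ and a continuous bracket map $[\cdot,\cdot]:\{(x,y)\in X\times X: d(x,y)\le\varepsilon_X\}\to X$ with $[x,x]=x$, $[x,[y,z]]=[x,z]$, $[[x,y],z]=[x,z]$, $\varphi[x,y]=[\varphi(x),\varphi(y)]$ whenever both sides are defined, and such that, for $0<\varepsilon\le\varepsilon_X$ and $X^s(x,\varepsilon)=\{y:d(x,y)<\varepsilon,[y,x]=x\}$, $X^u(x,\varepsilon)=\{y:d(x,y)<\varepsilon,[x,y]=x\}$, one has $d(\varphi(y),\varphi(z))\le\lambda^{-1}d(y,z)$ for $y,z\in X^s(x,\varepsilon)$ and $d(\varphi^{-1}(y),\varphi^{-1}(z))\le\lambda^{-1}d(y,z)$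 for $y,z\in X^u(x,\varepsilon)$. A constant $0<\varepsilon_X'\le\varepsilon_X/2$ is fixed such that $d(x,y)\le\varepsilon_X'$ implies $d(x,[x,y]),d(y,[x,y])<\varepsilon_X/2$. Irreducible: for all non-empty open $U,W\subset X$ there is $n\ge1$ with $\varphi^n(U)\cap W\ne\varnothing$. $\mathrm h(\varphi)$ is the topological entropy. Write $x\sim_s y$ if $d(\varphi^n(x),\varphi^n(y))\to0$ and $x\sim_u y$ if $d(\varphi^{-n}(x),\varphi^{-n}(y))\to0$ as $n\to+\infty$, with classes $X^s(x)$, $X^u(x)$; $X^s(P)=\bigcup_{p\in P}X^s(p)$, $X^u(Q)=\bigcup_{q\in Q}X^u(q)$, and $X^h(P,Q)=X^s(P)\cap X^u(Q)$, which is known to be countable and dense in $X$. A rectangle is a non-empty $R\subset X$ with $\mathrm{diam}(R)\le\varepsilon_X'$ and $[x,y]\in R$ for all $x,y\in R$. For a finite cover $\mathcal U$ of $X$ (with $\varnothing,X\notin\mathcal U$): $\mathrm{diam}(\mathcal U)$ is the largest diameter of a member; $\mathrm m(\mathcal U)$ is the largest number of distinct members with non-empty common intersection; $\mathrm{Leb}(\mathcal U)=\min_{x\in X}\max_{U\in\mathcal U}d(x,X\setminus U)$. A refining sequence of $\delta$-enlarged Markov partitions is a sequence of finite open covers $(\mathcal R_n^\delta)_{n\ge0}$ with $\mathcal R_0^\delta=\{X\}$ (obtained, by a known theorem, from $\delta$-enlarging a Markov partition of small diameter and its refinements) with the following properties for every $n\ge1$, where $C,c>0$ and $0<\theta\le\varepsilon_X$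 are constants: (1) $\mathcal R_n^\delta$ consists of open rectangles and $\mathcal R_{n+1}^\delta$ refines $\mathcal R_n^\delta$; (2) if $x,y$ lie in a common member of $\mathcal R_n^\delta$ then $d(\varphi^r(x),\varphi^r(y))<\varepsilon_X'$ for $|r|\le n-1$; (3) for $|r|\le n-1$, $\varphi^r(\mathcal R_n^\delta)$ refines $\mathcal R_{n-|r|}^\delta$; (4) $\mathrm{diam}(\mathcal R_n^\delta)\le\lambda^{-n+1}\theta$; (5) $\mathrm m(\mathcal R_n^\delta)\le(\#\mathcal R_1^\delta)^2$; (6) for every $\varepsilon\in(0,1)$, $ce^{2(\mathrm h(\varphi)-\varepsilon)n}<\#\mathcal R_n^\delta<Ce^{2(\mathrm h(\varphi)+\varepsilon)n}$ for all large $n$; (7) if $\varphi,\varphi^{-1}$ are Lipschitz with $\Lambda=\max\{\mathrm{Lip}(\varphi),\mathrm{Lip}(\varphi^{-1})\}$, there is $\eta\in(0,\theta]$ with $\mathrm{Leb}(\mathcal R_n^\delta)\ge\Lambda^{-n+1}\eta$ for all $n\ge1$. The symbol $\coprod$ denotes disjoint union, so the same subset of $X$ occurring at two different levels $n$ counts as two elements of $\mathcal R^\delta$. *)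

theory Defs
  imports "HOL-Analysis.Analysis"
begin

text \<open>The compact metric space \<open>X\<close> is the universe of a type of class \<open>metric_space\<close>.\<close>

section \<open>Smale spaces\<close>

definition local_stable :: "('a::metric_space \<Rightarrow> 'a \<Rightarrow> 'a) \<Rightarrow> 'a \<Rightarrow> real \<Rightarrow> 'a set" where
  "local_stable br x \<epsilon> = {y. dist x y < \<epsilon> \<and> br y x = x}"

definition local_unstable :: "('a::metric_space \<Rightarrow> 'a \<Rightarrow> 'a) \<Rightarrow> 'a \<Rightarrow> real \<Rightarrow> 'a set" where
  "local_unstable br x \<epsilon> = {y. dist x y < \<epsilon> \<and> br x y = x}"

text \<open>The bracket is a partial map: \<open>br x y\<close> is meaningful only if \<open>dist x y \<le> \<epsilon>X\<close>. Accordingly each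
  algebraic identity is guarded by the conditions under which all its brackets are defined.\<close>

locale smale_space =
  fixes \<phi> :: "'a::metric_space \<Rightarrow> 'a"
    and br :: "'a \<Rightarrow> 'a \<Rightarrow> 'a"
    and \<epsilon>X :: real
    and lam :: real
  assumes compact_space: "compact (UNIV :: 'a set)"
    and infinite_space: "infinite (UNIV :: 'a set)"
    and homeo: "homeomorphism UNIV UNIV \<phi> (inv \<phi>)"
    and \<epsilon>X_pos: "\<epsilon>X > 0"
    and lam_gt_1: "lam > 1"
    and br_continuous: "continuous_on {(x, y). dist x y \<le> \<epsilon>X} (\<lambda>(x, y). br x y)"
    and br_idem: "\<And>x. br x x = x"
    and br_right: "\<And>x y z. \<lbrakk>dist y z \<le> \<epsilon>X; dist x (br y z) \<le> \<epsilon>X; dist x z \<le> \<epsilon>X\<rbrakk>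
                     \<Longrightarrow> br x (br y z) = br x z"
    and br_left: "\<And>x y z. \<lbrakk>dist x y \<le> \<epsilon>X; dist (br x y) z \<le> \<epsilon>X; dist x z \<le> \<epsilon>X\<rbrakk>
                     \<Longrightarrow> br (br x y) z = br x z"
    and br_equivariant: "\<And>x y. \<lbrakk>dist x y \<le> \<epsilon>X; dist (\<phi> x) (\<phi> y) \<le> \<epsilon>X\<rbrakk>
                     \<Longrightarrow> \<phi> (br x y) = br (\<phi> x) (\<phi> y)"
    and stable_contraction: "\<And>\<epsilon> x y z.
          \<lbrakk>0 < \<epsilon>; \<epsilon> \<le> \<epsilon>X; y \<in> local_stable br x \<epsilon>; z \<in> local_stable br x \<epsilon>\<rbrakk>
                     \<Longrightarrow> dist (\<phi> y) (\<phi> z) \<le> inverse lam * dist y z"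
    and unstable_contraction: "\<And>\<epsilon> x y z.
          \<lbrakk>0 < \<epsilon>; \<epsilon> \<le> \<epsilon>X; y \<in> local_unstable br x \<epsilon>; z \<in> local_unstable br x \<epsilon>\<rbrakk>
                     \<Longrightarrow> dist (inv \<phi> y) (inv \<phi> z) \<le> inverse lam * dist y z"

text \<open>The condition on the constant \<open>\<epsilon>X'\<close> that bounds the size of rectangles.\<close>

definition bracket_scale :: "('a::metric_space \<Rightarrow> 'a \<Rightarrow> 'a) \<Rightarrow> real \<Rightarrow> real \<Rightarrow> bool" where
  "bracket_scale br \<epsilon>X \<epsilon>X' \<longleftrightarrow> 0 < \<epsilon>X' \<and> \<epsilon>X' \<le> \<epsilon>X / 2 \<and>
     (\<forall>x y. dist x y \<le> \<epsilon>X' \<longrightarrow> dist x (br x y) < \<epsilon>X / 2 \<and> dist y (br x y) < \<epsilon>X / 2)"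

definition irreducible_map :: "('a::topological_space \<Rightarrow> 'a) \<Rightarrow> bool" where
  "irreducible_map \<phi> \<longleftrightarrow>
     (\<forall>U W. open U \<longrightarrow> U \<noteq> {} \<longrightarrow> open W \<longrightarrow> W \<noteq> {} \<longrightarrow> (\<exists>n\<ge>1. (\<phi> ^^ n) ` U \<inter> W \<noteq> {}))"

text \<open>Integer iterates of a bijection.\<close>

definition iterate :: "('a \<Rightarrow> 'a) \<Rightarrow> int \<Rightarrow> 'a \<Rightarrow> 'a" where
  "iterate \<phi> j = (if j \<ge> 0 then \<phi> ^^ nat j else inv \<phi> ^^ nat (- j))"

definition periodic_orbit :: "('a \<Rightarrow> 'a) \<Rightarrow> 'a set \<Rightarrow> bool" where
  "periodic_orbit \<phi> P \<longleftrightarrow> (\<exists>p. (\<exists>n\<ge>1. (\<phi> ^^ n) p = p) \<and> P = range (\<lambda>k. (\<phi> ^^ k) p))"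

definition stably_equiv :: "('a::metric_space \<Rightarrow> 'a) \<Rightarrow> 'a \<Rightarrow> 'a \<Rightarrow> bool" where
  "stably_equiv \<phi> x y \<longleftrightarrow> (\<lambda>n. dist (iterate \<phi> (int n) x) (iterate \<phi> (int n) y)) \<longlonglongrightarrow> 0"

definition unstably_equiv :: "('a::metric_space \<Rightarrow> 'a) \<Rightarrow> 'a \<Rightarrow> 'a \<Rightarrow> bool" where
  "unstably_equiv \<phi> x y \<longleftrightarrow> (\<lambda>n. dist (iterate \<phi> (- int n) x) (iterate \<phi> (- int n) y)) \<longlonglongrightarrow> 0"

definition stable_set :: "('a::metric_space \<Rightarrow> 'a) \<Rightarrow> 'a set \<Rightarrow> 'a set" where
  "stable_set \<phi> P = (\<Union>p\<in>P. {x. stably_equiv \<phi> p x})"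

definition unstable_set :: "('a::metric_space \<Rightarrow> 'a) \<Rightarrow> 'a set \<Rightarrow> 'a set" where
  "unstable_set \<phi> Q = (\<Union>q\<in>Q. {x. unstably_equiv \<phi> q x})"

definition heteroclinic_set :: "('a::metric_space \<Rightarrow> 'a) \<Rightarrow> 'a set \<Rightarrow> 'a set \<Rightarrow> 'a set" where
  "heteroclinic_set \<phi> P Q = stable_set \<phi> P \<inter> unstable_set \<phi> Q"

section \<open>Topological entropy\<close>

text \<open>Bowen's definition by \<open>(n, \<epsilon>)\<close>-separated sets. The limit as \<open>\<epsilon>\<close> decreases to \<open>0\<close> is a
  supremum, because the growth rate is antitone in \<open>\<epsilon>\<close>.\<close>

definition separated_set :: "('a::metric_space \<Rightarrow> 'a) \<Rightarrow> nat \<Rightarrow> real \<Rightarrow> 'a set \<Rightarrow> bool" where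
  "separated_set \<phi> n \<epsilon> E \<longleftrightarrow>
     (\<forall>x\<in>E. \<forall>y\<in>E. x \<noteq> y \<longrightarrow> (\<exists>i<n. dist ((\<phi> ^^ i) x) ((\<phi> ^^ i) y) > \<epsilon>))"

definition topological_entropy :: "('a::metric_space \<Rightarrow> 'a) \<Rightarrow> ereal" where
  "topological_entropy \<phi> =
     (SUP \<epsilon>\<in>{0<..}. limsup (\<lambda>n.
        SUP E\<in>{E. finite E \<and> E \<noteq> {} \<and> separated_set \<phi> n \<epsilon> E}. ereal (ln (real (card E)) / real n)))"

section \<open>Covers\<close>

text \<open>\<open>proper_finite_cover\<close> excludes the empty set and the whole space as members;
  in particular \<open>- U\<close> is non-empty for every member \<open>U\<close>, so that \<open>infdist\<close> in
  \<open>lebesgue_number\<close> is a genuine distance. The infimum there is attained on a compact space.\<close>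

definition proper_finite_cover :: "'a set set \<Rightarrow> bool" where
  "proper_finite_cover \<U> \<longleftrightarrow> finite \<U> \<and> \<Union>\<U> = UNIV \<and> {} \<notin> \<U> \<and> UNIV \<notin> \<U>"

definition cover_diam :: "'a::metric_space set set \<Rightarrow> real" where
  "cover_diam \<U> = Max (diameter ` \<U>)"

definition cover_mult :: "'a set set \<Rightarrow> nat" where
  "cover_mult \<U> = Max {card \<F> | \<F>. \<F> \<subseteq> \<U> \<and> \<Inter>\<F> \<noteq> {}}"

definition lebesgue_number :: "'a::metric_space set set \<Rightarrow> real" where
  "lebesgue_number \<U> = (INF x. Max ((\<lambda>U. infdist x (- U)) ` \<U>))"

definition refines :: "'a set set \<Rightarrow> 'a set set \<Rightarrow> bool" where
  "refines \<V> \<U> \<longleftrightarrow> (\<forall>V\<in>\<V>. \<exists>U\<in>\<U>. V \<subseteq> U)"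

definition rectangle :: "('a::metric_space \<Rightarrow> 'a \<Rightarrow> 'a) \<Rightarrow> real \<Rightarrow> 'a set \<Rightarrow> bool" where
  "rectangle br \<epsilon>X' R \<longleftrightarrow> R \<noteq> {} \<and> diameter R \<le> \<epsilon>X' \<and> (\<forall>x\<in>R. \<forall>y\<in>R. br x y \<in> R)"

section \<open>Refining sequences of enlarged Markov partitions\<close>

definition is_lipschitz :: "('a::metric_space \<Rightarrow> 'a) \<Rightarrow> bool" where
  "is_lipschitz f \<longleftrightarrow> (\<exists>L. L-lipschitz_on UNIV f)"

definition lipschitz_const :: "('a::metric_space \<Rightarrow> 'a) \<Rightarrow> real" where
  "lipschitz_const f = Inf {L. L-lipschitz_on UNIV f}"

text \<open>The cover of level \<open>0\<close> is \<open>{X}\<close>; all other conditions concern levels \<open>n \<ge> 1\<close>.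
  The constants \<open>C\<close>, \<open>c\<close>, \<open>\<theta>\<close> depend neither on \<open>n\<close> nor on \<open>\<epsilon>\<close>. The variable \<open>h\<close> is the real
  value of the entropy, which is finite for every Smale space.\<close>

definition refining_markov_sequence ::
  "('a::metric_space \<Rightarrow> 'a) \<Rightarrow> ('a \<Rightarrow> 'a \<Rightarrow> 'a) \<Rightarrow> real \<Rightarrow> real \<Rightarrow> real \<Rightarrow> (nat \<Rightarrow> 'a set set) \<Rightarrow> bool" where
  "refining_markov_sequence \<phi> br \<epsilon>X lam \<epsilon>X' \<R> \<longleftrightarrow>
     \<R> 0 = {UNIV} \<and>
     (\<forall>n\<ge>1. proper_finite_cover (\<R> n)) \<and>
     (\<forall>n\<ge>1. (\<forall>R\<in>\<R> n. open R \<and> rectangle br \<epsilon>X' R) \<and> refines (\<R> (Suc n)) (\<R> n)) \<and>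
     (\<forall>n\<ge>1. \<forall>R\<in>\<R> n. \<forall>x\<in>R. \<forall>y\<in>R. \<forall>r::int.
        \<bar>r\<bar> \<le> int n - 1 \<longrightarrow> dist (iterate \<phi> r x) (iterate \<phi> r y) < \<epsilon>X') \<and>
     (\<forall>n\<ge>1. \<forall>r::int. \<bar>r\<bar> \<le> int n - 1 \<longrightarrow>
        refines ((\<lambda>R. iterate \<phi> r ` R) ` \<R> n) (\<R> (n - nat \<bar>r\<bar>))) \<and>
     (\<forall>n\<ge>1. cover_mult (\<R> n) \<le> (card (\<R> 1))\<^sup>2) \<and>
     (\<exists>h C c. topological_entropy \<phi> = ereal h \<and> C > 0 \<and> c > 0 \<and>
        (\<forall>\<epsilon>. 0 < \<epsilon> \<and> \<epsilon> < 1 \<longrightarrow>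
          (\<forall>\<^sub>F n in sequentially.
             c * exp (2 * (h - \<epsilon>) * real n) < real (card (\<R> n)) \<and>
             real (card (\<R> n)) < C * exp (2 * (h + \<epsilon>) * real n)))) \<and>
     (\<exists>\<theta>. 0 < \<theta> \<and> \<theta> \<le> \<epsilon>X \<and>
        (\<forall>n\<ge>1. cover_diam (\<R> n) \<le> lam powi (1 - int n) * \<theta>) \<and>
        (is_lipschitz \<phi> \<and> is_lipschitz (inv \<phi>) \<longrightarrow>
          (\<exists>\<eta>. 0 < \<eta> \<and> \<eta> \<le> \<theta> \<and>
             (\<forall>n\<ge>1. lebesgue_number (\<R> n) \<ge>
                max (lipschitz_const \<phi>) (lipschitz_const (inv \<phi>)) powi (1 - int n) * \<eta>))))"

text \<open>Disjoint union of all levels: a set occurring at two levels yields two elements.\<close>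

definition level_union :: "(nat \<Rightarrow> 'a set set) \<Rightarrow> (nat \<times> 'a set) set" where
  "level_union \<R> = (SIGMA n:UNIV. \<R> n)"

definition aperiodic_sample :: "('a \<Rightarrow> 'a) \<Rightarrow> (nat \<Rightarrow> 'a set set) \<Rightarrow> 'a set \<Rightarrow> bool" where
  "aperiodic_sample \<phi> \<R> \<G> \<longleftrightarrow>
     (\<exists>c. inj_on c (level_union \<R>) \<and>
          (\<forall>(n, R)\<in>level_union \<R>. c (n, R) \<in> R) \<and>
          \<G> = c ` level_union \<R>) \<and>
     (\<forall>j::int. j \<noteq> 0 \<longrightarrow> iterate \<phi> j ` \<G> \<inter> \<G> = {})"

end

theory Submission
  imports Defs
begin

text \<open>The bracket turns irreducibility into density of \<open>X\<^sup>s(P)\<close> and, for the inverse Smale space,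
  of \<open>X\<^sup>u(Q)\<close>; taking brackets of nearby points of these two sets shows that \<open>X\<^sup>h(P,Q)\<close> is dense.
  The orbit of a point of \<open>X\<^sup>h(P,Q)\<close> accumulates only on the finite set \<open>P \<union> Q\<close>. Since \<open>X\<close> has
  no isolated points, every non-empty open set contains a small ball, away from \<open>P \<union> Q\<close>, that
  still contains points of \<open>X\<^sup>h(P,Q)\<close> outside any given finite union of such orbits. The sample is
  then chosen one point at a time, each time avoiding the orbits of the previous points.\<close>

section \<open>Integer iterates and asymptotic equivalence\<close>

lemma iterate_0 [simp]: "iterate f 0 x = x"
  by (simp add: iterate_def)

lemma iterate_int: "iterate f (int n) = f ^^ n"
  by (simp add: iterate_def)

lemma iterate_add_1:
  assumes "bij f"
  shows "iterate f (j + 1) x = f (iterate f j x)"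
proof (cases "j \<ge> 0")
  case True
  then show ?thesis by (simp add: iterate_def nat_add_distrib)
next
  case False
  \<comment> \<open>For negative \<open>j\<close> the outermost \<open>inv f\<close> is cancelled by
    \<open>f\<close>. The value \<open>j = -1\<close> is split off because \<open>j + 1 = 0\<close>
    falls into the other branch of \<open>iterate\<close>.\<close>
  then have "nat (- j) = Suc (nat (- (j + 1)))" by simp
  with False show ?thesis
    using assms by (cases "j = -1") (auto simp: iterate_def bij_is_surj surj_f_inv_f)
qed

lemma iterate_diff_1:
  assumes "bij f"
  shows "iterate f (j - 1) x = inv f (iterate f j x)"
  using iterate_add_1[OF assms, of "j - 1" x] assms by (simp add: bij_is_inj)

lemma iterate_add:
  assumes "bij f"
  shows "iterate f (i + j) x = iterate f i (iterate f j x)"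
proof (induction i rule: int_induct[where k = 0])
  case (step1 i)
  then show ?case
    using iterate_add_1[OF assms, of "i + j" x] iterate_add_1[OF assms, of i "iterate f j x"]
    by (simp add: algebra_simps)
next
  case (step2 i)
  then show ?case
    using iterate_diff_1[OF assms, of "i + j" x] iterate_diff_1[OF assms, of i "iterate f j x"]
    by (simp add: algebra_simps)
qed simp

lemma iterate_inv:
  assumes "bij f"
  shows "iterate (inv f) j = iterate f (- j)"
  using assms by (auto simp: iterate_def inv_inv_eq)

lemma iterate_minus_iterate [simp]:
  assumes "bij f"
  shows "iterate f (- j) (iterate f j x) = x" "iterate f j (iterate f (- j) x) = x"
  using iterate_add[OF assms, of "- j" j x] iterate_add[OF assms, of j "- j" x] by simp_all

text \<open>Time reversal exchanges the two equivalences. This is what allows facts about unstable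
  sets to be obtained from stable sets of the inverse map.\<close>

lemma stably_equiv_inv:
  assumes "bij f"
  shows "stably_equiv (inv f) = unstably_equiv f"
  by (simp add: fun_eq_iff stably_equiv_def unstably_equiv_def iterate_inv[OF assms])

lemma stable_set_inv:
  assumes "bij f"
  shows "stable_set (inv f) P = unstable_set f P"
  by (simp add: stable_set_def unstable_set_def stably_equiv_inv[OF assms])

lemma stably_equiv_trans:
  assumes "stably_equiv f x y" "stably_equiv f y z"
  shows "stably_equiv f x z"
  unfolding stably_equiv_def
proof (rule tendsto_sandwich[OF _ _ tendsto_const])
  show "(\<lambda>n. dist (iterate f (int n) x) (iterate f (int n) y)
          + dist (iterate f (int n) y) (iterate f (int n) z)) \<longlonglongrightarrow> 0"
    using tendsto_add[OF assms[unfolded stably_equiv_def]] by simp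
qed (auto intro: dist_triangle always_eventually)

text \<open>The defining null sequence is merely shifted by \<open>j\<close>. For negative
  \<open>j\<close> the shifted index is cut off by \<open>nat\<close>, which affects only finitely
  many terms.\<close>

lemma stably_equiv_iterate:
  assumes "bij f" "stably_equiv f x y"
  shows "stably_equiv f (iterate f j x) (iterate f j y)"
proof -
  let ?d = "\<lambda>i. dist (iterate f i x) (iterate f i y)"
  have "filterlim (\<lambda>n. nat (int n + j)) sequentially sequentially"
    unfolding filterlim_at_top
  proof
    fix Z show "\<forall>\<^sub>F n in sequentially. Z \<le> nat (int n + j)"
      using eventually_ge_at_top[of "Z + nat \<bar>j\<bar>"] by eventually_elim linarith
  qed
  from filterlim_compose[OF assms(2)[unfolded stably_equiv_def] this]
  have "(\<lambda>n. ?d (int (nat (int n + j)))) \<longlonglongrightarrow> 0" .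
  moreover have "\<forall>\<^sub>F n in sequentially. ?d (int (nat (int n + j))) = ?d (int n + j)"
    using eventually_ge_at_top[of "nat \<bar>j\<bar>"]
  proof eventually_elim
    case (elim n)
    then have "int (nat (int n + j)) = int n + j" by linarith
    then show ?case by (simp only:)
  qed
  ultimately have "(\<lambda>n. ?d (int n + j)) \<longlonglongrightarrow> 0"
    by (rule Lim_transform_eventually)
  then show ?thesis
    by (simp add: stably_equiv_def iterate_add[OF assms(1)])
qed

section \<open>Periodic orbits and invariance\<close>

lemma periodic_orbit_finite:
  assumes "periodic_orbit f P"
  shows "finite P"
proof -
  obtain p n where n: "n \<ge> 1" "(f ^^ n) p = p" and P: "P = range (\<lambda>k. (f ^^ k) p)"
    using assms by (auto simp: periodic_orbit_def)
  have "P \<subseteq> (\<lambda>k. (f ^^ k) p) ` {..<n}"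
    unfolding P
  proof clarify
    fix k
    have "(f ^^ k) p = (f ^^ (k mod n)) p" using n(2) by (simp add: funpow_mod_eq)
    then show "(f ^^ k) p \<in> (\<lambda>k. (f ^^ k) p) ` {..<n}" using n(1) by simp
  qed
  then show ?thesis by (rule finite_subset) simp
qed

text \<open>The orbit is finite and forward invariant, and an injective self-map of a finite set is
  onto.\<close>

lemma periodic_orbit_image:
  assumes "periodic_orbit f P" "bij f"
  shows "f ` P = P"
proof (rule card_subset_eq)
  show "finite P" using assms(1) by (rule periodic_orbit_finite)
  show "f ` P \<subseteq> P"
    using assms(1) unfolding periodic_orbit_def by clarsimp (metis comp_apply funpow.simps(2) rangeI)
  show "card (f ` P) = card P"
    using assms(2) by (meson bij_is_inj card_image inj_on_subset subset_UNIV)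
qed

lemma iterate_mem_invariant:
  assumes "bij f" "f ` P = P" "p \<in> P"
  shows "iterate f j p \<in> P"
proof (induction j rule: int_induct[where k = 0])
  case base
  then show ?case using assms(3) by simp
next
  case (step1 i)
  then show ?case using assms(2) iterate_add_1[OF assms(1)] by auto
next
  case (step2 i)
  then show ?case using assms(1,2) iterate_diff_1[OF assms(1)] by (metis bij_is_inj image_inv_f_f imageI)
qed

lemma stable_set_iterate:
  assumes "bij f" "f ` P = P" "x \<in> stable_set f P"
  shows "iterate f j x \<in> stable_set f P"
  using assms stably_equiv_iterate[OF assms(1)] iterate_mem_invariant[OF assms(1,2)]
  unfolding stable_set_def by blast

text \<open>An orbit segment of \<open>f\<close> from \<open>W\<close> to \<open>U\<close>, read
  backwards, is an orbit segment of \<open>inv f\<close> from \<open>U\<close> to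
  \<open>W\<close>.\<close>

lemma irreducible_map_inv:
  assumes "bij f" "irreducible_map f"
  shows "irreducible_map (inv f)"
  unfolding irreducible_map_def
proof (intro allI impI)
  fix U W :: "'a set"
  assume "open U" "U \<noteq> {}" "open W" "W \<noteq> {}"
  then obtain n where n: "n \<ge> 1" "(f ^^ n) ` W \<inter> U \<noteq> {}"
    using assms(2) unfolding irreducible_map_def by meson
  then obtain x where x: "x \<in> W" "(f ^^ n) x \<in> U" by blast
  have "(inv f ^^ n) ((f ^^ n) x) = x"
    using iterate_minus_iterate(1)[OF assms(1), of "int n" x] iterate_inv[OF assms(1), of "int n"]
    by (simp add: iterate_int flip: iterate_inv[OF assms(1)])
  with x have "x \<in> (inv f ^^ n) ` U \<inter> W" by force
  with n(1) show "\<exists>n\<ge>1. (inv f ^^ n) ` U \<inter> W \<noteq> {}" by blast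
qed

section \<open>Recurrence of asymptotic orbits and isolated points\<close>

lemma eventually_far_from_stable_limit:
  assumes "bij f" "f ` P = P" "x \<in> stable_set f P" "r > 0" "\<And>v p. v \<in> V \<Longrightarrow> p \<in> P \<Longrightarrow> dist p v \<ge> r"
  shows "\<exists>N. \<forall>n\<ge>N. iterate f (int n) x \<notin> V"
proof -
  obtain p where p: "p \<in> P" "stably_equiv f p x" using assms(3) by (auto simp: stable_set_def)
  then obtain N where "\<And>n. n \<ge> N \<Longrightarrow> dist (iterate f (int n) p) (iterate f (int n) x) < r"
    using assms(4) unfolding stably_equiv_def lim_sequentially by auto
  \<comment> \<open>From time \<open>N\<close> on, \<open>x\<close> is closer than \<open>r\<close>
    to the orbit of \<open>p\<close>. That orbit stays in \<open>P\<close> by invariance, and points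
    of \<open>V\<close> are at distance at least \<open>r\<close> from \<open>P\<close>.\<close>
  then show ?thesis
    using assms(5) iterate_mem_invariant[OF assms(1,2) p(1)] by (meson not_le)
qed

text \<open>A periodic point returns to itself at arbitrarily late times. A point outside the finite
  set \<open>P\<close> has positive distance from it, so an orbit converging to \<open>P\<close>
  cannot keep returning there.\<close>

lemma stable_set_aperiodic:
  assumes "bij f" "finite P" "f ` P = P" "x \<in> stable_set f P" "x \<notin> P" "j \<noteq> 0"
  shows "iterate f j x \<noteq> x"
proof
  assume j: "iterate f j x = x"
  then have "iterate f (- j) x = x" using iterate_minus_iterate(1)[OF assms(1), of j x] by simp
  with j have per: "iterate f (int (nat \<bar>j\<bar>)) x = x" by (cases "j \<ge> 0") auto
  have per_mult: "iterate f (int (m * nat \<bar>j\<bar>)) x = x" for m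
  proof (induction m)
    case (Suc m)
    then show ?case
      using iterate_add[OF assms(1), of "int (nat \<bar>j\<bar>)" "int (m * nat \<bar>j\<bar>)" x] per
      by (simp only: mult_Suc of_nat_add)
  qed simp
  obtain r where "r > 0" "\<And>p. p \<in> P \<Longrightarrow> dist p x \<ge> r"
    using finite_set_avoid[OF assms(2), of x] assms(5) by (metis dist_commute)
  then obtain N where N: "\<And>n. n \<ge> N \<Longrightarrow> iterate f (int n) x \<noteq> x"
    using eventually_far_from_stable_limit[OF assms(1,3,4), of r "{x}"] by auto
  have "nat \<bar>j\<bar> \<ge> 1" using assms(6) by linarith
  then have "N \<le> N * nat \<bar>j\<bar>" by simp
  from N[OF this] per_mult show False by blast
qed

text \<open>Forward iterates finally avoid \<open>V\<close> because they approach \<open>P\<close>,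
  backward iterates because they approach \<open>Q\<close>. Only a bounded range of times
  remains.\<close>

lemma finite_heteroclinic_orbit_Int:
  assumes "bij f" "f ` P = P" "f ` Q = Q" "x \<in> heteroclinic_set f P Q" "r > 0"
    and "\<And>v p. v \<in> V \<Longrightarrow> p \<in> P \<union> Q \<Longrightarrow> dist p v \<ge> r"
  shows "finite (range (\<lambda>j. iterate f j x) \<inter> V)"
proof -
  have inv_Q: "inv f ` Q = Q"
    using assms(1,3) by (metis bij_is_inj image_inv_f_f)
  obtain N where N: "\<And>n. n \<ge> N \<Longrightarrow> iterate f (int n) x \<notin> V"
    using eventually_far_from_stable_limit[OF assms(1,2) _ assms(5), of x V] assms(4,6)
    by (auto simp: heteroclinic_set_def)
  obtain M where M: "\<And>n. n \<ge> M \<Longrightarrow> iterate f (- int n) x \<notin> V"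
    using eventually_far_from_stable_limit[OF bij_imp_bij_inv[OF assms(1)] inv_Q _ assms(5), of x V] assms(4,6)
    by (auto simp: heteroclinic_set_def stable_set_inv[OF assms(1)] iterate_inv[OF assms(1)])
  have "j \<in> {- int M..int N}" if "iterate f j x \<in> V" for j
    using N[of "nat j"] M[of "nat (- j)"] that by (cases "j \<ge> 0") force+
  then have "range (\<lambda>j. iterate f j x) \<inter> V \<subseteq> (\<lambda>j. iterate f j x) ` {- int M..int N}"
    by blast
  then show ?thesis by (rule finite_subset) simp
qed

text \<open>Irreducibility for \<open>{x}\<close> and \<open>{x}\<close> would make \<open>x\<close>
  periodic. The complement of its finite orbit is then open and non-empty, yet never visited from
  \<open>{x}\<close>.\<close>

lemma irreducible_no_isolated_point:
  fixes f :: "'a::t1_space \<Rightarrow> 'a" and x :: 'a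
  assumes "irreducible_map f" "infinite (UNIV :: 'a set)"
  shows "\<not> open {x}"
proof
  assume x: "open {x}"
  obtain n where n: "n \<ge> 1" "(f ^^ n) x = x"
    using assms(1) x unfolding irreducible_map_def by force
  define O' where "O' = range (\<lambda>k. (f ^^ k) x)"
  have fin: "finite O'"
    using n by (intro periodic_orbit_finite[of f]) (auto simp: periodic_orbit_def O'_def)
  then have "open (- O')" "- O' \<noteq> {}"
    using assms(2) by (metis finite_imp_closed open_Compl) (metis fin assms(2) Compl_empty_eq double_complement)
  then obtain m where "(f ^^ m) ` {x} \<inter> - O' \<noteq> {}"
    using assms(1) x unfolding irreducible_map_def by blast
  then show False by (auto simp: O'_def)
qed

section \<open>The inverse Smale space\<close>

lemma (in smale_space) bij: "bij \<phi>"
  using homeo by (metis bij_betw_def homeomorphism_def inj_on_inverseI)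

text \<open>Swapping the arguments of the bracket turns local stable sets into local unstable ones
  and interchanges \<open>br_left\<close> with \<open>br_right\<close>. Equivariance is that of
  \<open>\<phi>\<close> at the preimages.\<close>

lemma (in smale_space) smale_space_inverse: "smale_space (inv \<phi>) (\<lambda>x y. br y x) \<epsilon>X lam"
proof
  have inv_inv: "inv (inv \<phi>) = \<phi>" using bij by (rule inv_inv_eq)
  show "homeomorphism UNIV UNIV (inv \<phi>) (inv (inv \<phi>))"
    unfolding inv_inv using homeo by (rule homeomorphism_symD)
  have "continuous_on {(x, y). dist x y \<le> \<epsilon>X} ((\<lambda>(x, y). br x y) \<circ> prod.swap)"
    by (intro continuous_on_compose continuous_on_swap continuous_on_subset[OF br_continuous])
      (auto simp: dist_commute)
  then show "continuous_on {(x, y). dist x y \<le> \<epsilon>X} (\<lambda>(x, y). br y x)"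
    by (simp add: case_prod_unfold o_def)
  show "inv \<phi> (br y x) = br (inv \<phi> y) (inv \<phi> x)"
    if "dist x y \<le> \<epsilon>X" "dist (inv \<phi> x) (inv \<phi> y) \<le> \<epsilon>X" for x y
  proof -
    have "\<phi> (br (inv \<phi> y) (inv \<phi> x)) = br y x"
      using br_equivariant[of "inv \<phi> y" "inv \<phi> x"] that bij
      by (simp add: dist_commute bij_is_surj surj_f_inv_f)
    then show ?thesis using bij by (metis bij_inv_eq_iff)
  qed
  show "dist (inv \<phi> y) (inv \<phi> z) \<le> inverse lam * dist y z"
    if "0 < \<epsilon>" "\<epsilon> \<le> \<epsilon>X" "y \<in> local_stable (\<lambda>x y. br y x) x \<epsilon>" "z \<in> local_stable (\<lambda>x y. br y x) x \<epsilon>"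
    for \<epsilon> x y z
    using that unstable_contraction[of \<epsilon> y x z] by (simp add: local_stable_def local_unstable_def)
  show "dist (inv (inv \<phi>) y) (inv (inv \<phi>) z) \<le> inverse lam * dist y z"
    if "0 < \<epsilon>" "\<epsilon> \<le> \<epsilon>X" "y \<in> local_unstable (\<lambda>x y. br y x) x \<epsilon>" "z \<in> local_unstable (\<lambda>x y. br y x) x \<epsilon>"
    for \<epsilon> x y z
    using that stable_contraction[of \<epsilon> y x z] by (simp add: inv_inv local_stable_def local_unstable_def)
qed (use compact_space infinite_space \<epsilon>X_pos lam_gt_1 br_idem br_left br_right dist_commute in
      \<open>simp_all add: dist_commute\<close>)

section \<open>Local contraction and the bracket\<close>

context smale_space
begin

text \<open>Membership is carried through the induction because contraction is available only inside
  a local stable set. One contraction step keeps the distance below \<open>\<epsilon>X\<close>,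
  where equivariance transports the bracket identity.\<close>

lemma local_stable_funpow:
  assumes "y \<in> local_stable br x \<epsilon>X"
  shows "(\<phi> ^^ n) y \<in> local_stable br ((\<phi> ^^ n) x) \<epsilon>X \<and>
    dist ((\<phi> ^^ n) x) ((\<phi> ^^ n) y) \<le> inverse lam ^ n * dist x y"
proof (induction n)
  case 0
  then show ?case using assms by simp
next
  case (Suc n)
  let ?x = "(\<phi> ^^ n) x" and ?y = "(\<phi> ^^ n) y"
  have "?x \<in> local_stable br ?x \<epsilon>X" by (simp add: local_stable_def br_idem \<epsilon>X_pos)
  then have contr: "dist (\<phi> ?x) (\<phi> ?y) \<le> inverse lam * dist ?x ?y"
    using stable_contraction[of \<epsilon>X] Suc.IH \<epsilon>X_pos by simp
  moreover have "inverse lam * dist ?x ?y \<le> 1 * dist ?x ?y"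
    using lam_gt_1 by (intro mult_right_mono) (auto simp: inverse_le_1_iff)
  ultimately have lt: "dist (\<phi> ?x) (\<phi> ?y) < \<epsilon>X"
    using Suc.IH by (simp add: local_stable_def)
  have "\<phi> ?y \<in> local_stable br (\<phi> ?x) \<epsilon>X"
    using br_equivariant[of ?y ?x] lt Suc.IH by (simp add: local_stable_def dist_commute)
  moreover have "inverse lam * dist ?x ?y \<le> inverse lam * (inverse lam ^ n * dist x y)"
    using Suc.IH lam_gt_1 by (intro mult_left_mono) auto
  ultimately show ?case using contr by simp
qed

lemma local_stable_imp_stably_equiv:
  assumes "y \<in> local_stable br x \<epsilon>X"
  shows "stably_equiv \<phi> x y"
  unfolding stably_equiv_def iterate_int
proof (rule tendsto_sandwich[OF _ _ tendsto_const])
  have "(\<lambda>n. inverse lam ^ n) \<longlonglongrightarrow> 0"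
    using lam_gt_1 by (intro LIMSEQ_power_zero) (auto simp: inverse_less_1_iff)
  then show "(\<lambda>n. inverse lam ^ n * dist x y) \<longlonglongrightarrow> 0"
    by (rule tendsto_mult_left_zero)
qed (use local_stable_funpow[OF assms] in auto)

lemma local_unstable_funpow:
  assumes "y \<in> local_unstable br x \<epsilon>X"
  shows "dist ((inv \<phi> ^^ n) x) ((inv \<phi> ^^ n) y) \<le> dist x y"
proof -
  interpret inverse: smale_space "inv \<phi>" "\<lambda>x y. br y x" \<epsilon>X lam by (rule smale_space_inverse)
  have "dist ((inv \<phi> ^^ n) x) ((inv \<phi> ^^ n) y) \<le> inverse lam ^ n * dist x y"
    using inverse.local_stable_funpow[of y x n] assms by (simp add: local_stable_def local_unstable_def)
  also have "\<dots> \<le> 1 * dist x y"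
    using lam_gt_1 by (intro mult_right_mono power_le_one) (auto simp: inverse_le_1_iff)
  finally show ?thesis by simp
qed

lemma bracket_in_local_sets:
  assumes "dist x y \<le> \<epsilon>X" "dist x (br x y) < \<epsilon>X" "dist y (br x y) < \<epsilon>X"
  shows "br x y \<in> local_stable br x \<epsilon>X" "br x y \<in> local_unstable br y \<epsilon>X"
  \<comment> \<open>The two instances are \<open>br (br x y) x = br x x\<close> and
    \<open>br y (br x y) = br y y\<close>.\<close>
  using br_left[of x y x] br_right[of x y y] assms \<epsilon>X_pos
  by (auto simp: local_stable_def local_unstable_def br_idem dist_commute)

text \<open>Continuity at \<open>(z, z)\<close>, where the bracket has the value \<open>z\<close>.
  It joins nearby points \<open>a\<close> and \<open>b\<close> by a point on the stable side of
  \<open>a\<close> and the unstable side of \<open>b\<close>.\<close>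

lemma bracket_near_diagonal:
  assumes "e > 0"
  obtains \<delta> where "0 < \<delta>" "\<delta> \<le> e"
    and "\<And>a b. dist a z < \<delta> \<Longrightarrow> dist b z < \<delta> \<Longrightarrow>
           dist (br a b) z < e \<and> br a b \<in> local_stable br a \<epsilon>X \<and> br a b \<in> local_unstable br b \<epsilon>X"
proof -
  \<comment> \<open>Any two points within \<open>\<epsilon>X / 2\<close> of \<open>z\<close> are
    closer than \<open>\<epsilon>X\<close>, as \<open>bracket_in_local_sets\<close>
    requires.\<close>
  define e' where "e' = min e (\<epsilon>X / 2)"
  have e': "0 < e'" "e' \<le> e" "e' \<le> \<epsilon>X / 2" using assms \<epsilon>X_pos by (auto simp: e'_def)
  have "(z, z) \<in> {(x, y). dist x y \<le> \<epsilon>X}" using \<epsilon>X_pos by simp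
  then obtain d where d: "d > 0" and
    cont: "\<And>a b. dist a b \<le> \<epsilon>X \<Longrightarrow> dist (a, b) (z, z) < d \<Longrightarrow> dist (br a b) (br z z) < e'"
    using br_continuous e'(1) unfolding continuous_on_iff by (metis (no_types, lifting) case_prod_conv mem_Collect_eq)
  \<comment> \<open>The half of \<open>d\<close> suffices because the product distance is at most
    the sum of the coordinate distances.\<close>
  define \<delta> where "\<delta> = min (d / 2) e'"
  show thesis
  proof
    show "0 < \<delta>" "\<delta> \<le> e" using d e' by (auto simp: \<delta>_def)
    fix a b assume ab: "dist a z < \<delta>" "dist b z < \<delta>"
    then have close: "dist a z < e'" "dist b z < e'" "dist a z + dist b z < d"
      by (auto simp: \<delta>_def)
    have le: "dist a b \<le> \<epsilon>X"
      using dist_triangle2[of a b z] close e' by linarith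
    have "dist (a, b) (z, z) \<le> dist a z + dist b z"
      unfolding dist_Pair_Pair by (rule sqrt_sum_squares_le_sum) auto
    with cont[OF le] close have near: "dist (br a b) z < e'" by (simp add: br_idem)
    have "dist a (br a b) < \<epsilon>X" "dist b (br a b) < \<epsilon>X"
      using dist_triangle2[of a "br a b" z] dist_triangle2[of b "br a b" z] near close e' by linarith+
    with near e'(2) le bracket_in_local_sets
    show "dist (br a b) z < e \<and> br a b \<in> local_stable br a \<epsilon>X \<and> br a b \<in> local_unstable br b \<epsilon>X"
      by simp
  qed
qed

section \<open>Density of stable and heteroclinic sets\<close>

lemma stable_set_dense:
  assumes "irreducible_map \<phi>" "\<phi> ` P = P" "P \<noteq> {}" "open U" "U \<noteq> {}"
  shows "stable_set \<phi> P \<inter> U \<noteq> {}"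
proof -
  obtain z e where e: "e > 0" "ball z e \<subseteq> U" using assms(4,5) openE by blast
  obtain p where p: "p \<in> P" using assms(3) by blast
  \<comment> \<open>One third is spent on the distance from \<open>z\<close> to \<open>v\<close>,
    two thirds on that from \<open>w\<close> to \<open>y\<close> by way of \<open>p\<close>.\<close>
  from e(1) have "e / 3 > 0" by simp
  then obtain \<delta> where \<delta>: "0 < \<delta>" "\<delta> \<le> e / 3"
    and br: "\<And>a b. dist a p < \<delta> \<Longrightarrow> dist b p < \<delta> \<Longrightarrow>
           dist (br a b) p < e / 3 \<and> br a b \<in> local_stable br a \<epsilon>X \<and> br a b \<in> local_unstable br b \<epsilon>X"
    using bracket_near_diagonal[where z = p] by metis
  have "ball z (e / 3) \<noteq> {}" "ball p \<delta> \<noteq> {}" using e(1) \<delta>(1) by auto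
  then obtain n where "(\<phi> ^^ n) ` ball z (e / 3) \<inter> ball p \<delta> \<noteq> {}"
    using assms(1) open_ball unfolding irreducible_map_def by meson
  then obtain v where v: "v \<in> ball z (e / 3)" "(\<phi> ^^ n) v \<in> ball p \<delta>"
    by blast
  define w where "w = (\<phi> ^^ n) v"
  \<comment> \<open>The point \<open>y\<close> is stably equivalent to \<open>p\<close> and lies in
    the local unstable set of \<open>w\<close>. Going back \<open>n\<close> steps does not increase
    its distance to the orbit of \<open>w\<close>, so it ends near \<open>v\<close> and hence near
    \<open>z\<close>, still in the invariant stable set.\<close>
  define y where "y = br p w"
  have w: "dist w p < \<delta>" using v(2) by (simp add: w_def dist_commute)
  note y = br[of p w, OF _ w, folded y_def]
  have inv_w: "iterate \<phi> (- int n) w = v"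
    using iterate_minus_iterate(1)[OF bij, of "int n" v] by (simp add: w_def iterate_int)
  have "dist (iterate \<phi> (- int n) w) (iterate \<phi> (- int n) y) \<le> dist w y"
    using local_unstable_funpow[of y w n] y \<delta>(1) iterate_inv[OF bij, of "int n"] by (simp add: iterate_int)
  also have "\<dots> < e / 3 + e / 3"
    using dist_triangle2[of w y p] w y \<delta> by auto
  finally have "dist z (iterate \<phi> (- int n) y) < e"
    using dist_triangle[of z "iterate \<phi> (- int n) y" v] v(1) inv_w by simp
  moreover have "y \<in> stable_set \<phi> P"
    using y \<delta>(1) p local_stable_imp_stably_equiv[of y p] by (auto simp: stable_set_def)
  then have "iterate \<phi> (- int n) y \<in> stable_set \<phi> P"
    by (rule stable_set_iterate[OF bij assms(2)])
  ultimately show ?thesis using e(2) by auto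
qed

text \<open>\<open>stable_set_dense\<close> for the space and for its inverse gives \<open>a\<close>
  and \<open>b\<close> near \<open>z\<close>. Their bracket inherits the stable class of
  \<open>a\<close> and the unstable class of \<open>b\<close>.\<close>

lemma heteroclinic_set_dense:
  assumes "irreducible_map \<phi>" "\<phi> ` P = P" "P \<noteq> {}" "\<phi> ` Q = Q" "Q \<noteq> {}" "open U" "U \<noteq> {}"
  shows "heteroclinic_set \<phi> P Q \<inter> U \<noteq> {}"
proof -
  interpret inverse: smale_space "inv \<phi>" "\<lambda>x y. br y x" \<epsilon>X lam by (rule smale_space_inverse)
  obtain z e where e: "e > 0" "ball z e \<subseteq> U" using assms(6,7) openE by blast
  obtain \<delta> where \<delta>: "0 < \<delta>"
    and br: "\<And>a b. dist a z < \<delta> \<Longrightarrow> dist b z < \<delta> \<Longrightarrow>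
           dist (br a b) z < e \<and> br a b \<in> local_stable br a \<epsilon>X \<and> br a b \<in> local_unstable br b \<epsilon>X"
    using bracket_near_diagonal[OF e(1), where z = z] by metis
  have ball: "open (ball z \<delta>)" "ball z \<delta> \<noteq> {}" using \<delta> by auto
  obtain a where a: "dist a z < \<delta>" "a \<in> stable_set \<phi> P"
    using stable_set_dense[OF assms(1-3) ball] by (auto simp: dist_commute)
  have "inv \<phi> ` Q = Q" using assms(4) bij by (metis bij_is_inj image_inv_f_f)
  from inverse.stable_set_dense[OF irreducible_map_inv[OF bij assms(1)] this assms(5) ball]
  obtain b where b: "dist b z < \<delta>" "b \<in> stable_set (inv \<phi>) Q"
    by (auto simp: dist_commute)
  note ab = br[OF a(1) b(1)]
  have "br a b \<in> stable_set \<phi> P"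
    using a(2) ab local_stable_imp_stably_equiv stably_equiv_trans unfolding stable_set_def by blast
  moreover have "br a b \<in> local_stable (\<lambda>x y. br y x) b \<epsilon>X"
    using ab by (simp add: local_stable_def local_unstable_def)
  then have "br a b \<in> stable_set (inv \<phi>) Q"
    using b(2) inverse.local_stable_imp_stably_equiv stably_equiv_trans unfolding stable_set_def by blast
  ultimately have "br a b \<in> heteroclinic_set \<phi> P Q"
    by (simp add: heteroclinic_set_def stable_set_inv[OF bij])
  with ab e(2) show ?thesis by (auto simp: dist_commute)
qed

text \<open>This is the inductive step of the choice: \<open>F\<close> holds the points chosen so
  far. Staying outside \<open>P\<close> ensures that the new point is aperiodic.\<close>

lemma heteroclinic_point_avoiding_orbits:
  assumes "irreducible_map \<phi>" "periodic_orbit \<phi> P" "periodic_orbit \<phi> Q" "open U" "U \<noteq> {}"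
    and "finite F" "F \<subseteq> heteroclinic_set \<phi> P Q"
  shows "\<exists>x \<in> U \<inter> heteroclinic_set \<phi> P Q - P. \<forall>y\<in>F. \<forall>j. iterate \<phi> j y \<noteq> x"
proof -
  have inv: "\<phi> ` P = P" "\<phi> ` Q = Q" and fin: "finite (P \<union> Q)"
    using assms(2,3) by (simp_all add: bij periodic_orbit_finite periodic_orbit_image)
  have ne: "P \<noteq> {}" "Q \<noteq> {}" using assms(2,3) by (auto simp: periodic_orbit_def)
  \<comment> \<open>Non-empty open sets are infinite: in a finite one, removing all points but one
    would leave an open singleton.\<close>
  have perfect: "W - A \<noteq> {}" if W: "open W" "W \<noteq> {}" "finite A" for W A :: "'a set"
  proof
    assume "W - A = {}"
    then have "finite W" using W(3) by (simp add: finite_subset)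
    obtain x where "x \<in> W" using W(2) by blast
    then have "{x} = W - (W - {x})" by blast
    then have "open {x}"
      using W(1) \<open>finite W\<close> by (metis finite_Diff finite_imp_closed open_Diff)
    then show False using irreducible_no_isolated_point[OF assms(1) infinite_space] by blast
  qed
  obtain z where z: "z \<in> U" "z \<notin> P \<union> Q" using perfect[OF assms(4,5) fin] by blast
  obtain r where r: "r > 0" "\<And>p. p \<in> P \<union> Q \<Longrightarrow> dist z p \<ge> r"
    using finite_set_avoid[OF fin, of z] z(2) by metis
  \<comment> \<open>Half the radius keeps all of \<open>V\<close> at distance at least
    \<open>r / 2\<close> from \<open>P\<close> and \<open>Q\<close>, so each orbit from
    \<open>F\<close> meets \<open>V\<close> in a finite set that can be removed.\<close>
  define V where "V = U \<inter> ball z (r / 2)"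
  have V: "open V" "z \<in> V" using assms(4) z(1) r(1) by (auto simp: V_def)
  have far: "dist p v \<ge> r / 2" if "v \<in> V" "p \<in> P \<union> Q" for v p
    using dist_triangle[of z p v] that r(2)[of p] by (simp add: V_def dist_commute)
  have "finite (range (\<lambda>j. iterate \<phi> j y) \<inter> V)" if "y \<in> F" for y
    using that assms(7) r(1) far by (intro finite_heteroclinic_orbit_Int[OF bij inv, of _ "r / 2"]) auto
  then have finA: "finite (\<Union>y\<in>F. range (\<lambda>j. iterate \<phi> j y) \<inter> V)" (is "finite ?A")
    using assms(6) by blast
  have "open (V - ?A)"
    using V(1) finite_imp_closed[OF finA] by (rule open_Diff)
  moreover have "V - ?A \<noteq> {}"
    by (rule perfect[OF V(1) _ finA]) (use V(2) in blast)
  ultimately have "heteroclinic_set \<phi> P Q \<inter> (V - ?A) \<noteq> {}"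
    by (rule heteroclinic_set_dense[OF assms(1) inv(1) ne(1) inv(2) ne(2)])
  then obtain x where x: "x \<in> heteroclinic_set \<phi> P Q" "x \<in> V" "x \<notin> ?A"
    by blast
  have "x \<notin> P" using far[OF x(2), of x] r(1) by auto
  moreover have "x \<in> U" using x(2) by (simp add: V_def)
  moreover have "iterate \<phi> j y \<noteq> x" if "y \<in> F" for y j
    using x(2,3) that by blast
  ultimately show ?thesis using x(1) by blast
qed

end

section \<open>Successive choice of points in distinct orbits\<close>

lemma choose_points_in_distinct_orbits:
  assumes "bij f" "countable A"
    and aperiodic: "\<And>x j. x \<in> H \<Longrightarrow> j \<noteq> 0 \<Longrightarrow> iterate f j x \<noteq> x"
    and ex: "\<And>a F. a \<in> A \<Longrightarrow> finite F \<Longrightarrow> F \<subseteq> H \<Longrightarrow> \<exists>x \<in> S a \<inter> H. \<forall>y\<in>F. \<forall>j. iterate f j y \<noteq> x"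
  shows "\<exists>c. inj_on c A \<and> (\<forall>a\<in>A. c a \<in> S a \<inter> H) \<and> (\<forall>j. j \<noteq> 0 \<longrightarrow> iterate f j ` c ` A \<inter> c ` A = {})"
proof (cases "A = {}")
  case False
  \<comment> \<open>For finite \<open>A\<close> this enumeration repeats elements. That is harmless:
    the final \<open>c\<close> reads \<open>g\<close> only at the codes
    \<open>to_nat_on A a\<close>.\<close>
  define e where "e = from_nat_into A"
  have e: "e n \<in> A" for n using False by (simp add: e_def from_nat_into)
  \<comment> \<open>Each new point avoids the full two-sided orbits of all earlier ones; time
    reversal then makes the condition symmetric in the two indices.\<close>
  have "\<exists>g. \<forall>n. g n \<in> S (e n) \<inter> H \<and> (\<forall>k<n. \<forall>j. iterate f j (g k) \<noteq> g n)"
  proof (rule dependent_wellorder_choice)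
    fix n :: nat and g
    assume "\<And>m. m < n \<Longrightarrow> g m \<in> S (e m) \<inter> H \<and> (\<forall>k<m. \<forall>j. iterate f j (g k) \<noteq> g m)"
    then have "g ` {..<n} \<subseteq> H" by auto
    from ex[OF e[of n] _ this] show "\<exists>r. r \<in> S (e n) \<inter> H \<and> (\<forall>k<n. \<forall>j. iterate f j (g k) \<noteq> r)"
      by auto
  qed auto
  then obtain g where g: "\<And>n. g n \<in> S (e n) \<inter> H"
    and new: "\<And>k n j. k < n \<Longrightarrow> iterate f j (g k) \<noteq> g n"
    by blast
  have distinct: "iterate f j (g k) \<noteq> g n" if "k \<noteq> n" for k n j
  proof (cases "k < n")
    case False
    then show ?thesis
      using new[of n k "- j"] that iterate_minus_iterate(1)[OF assms(1), of j "g k"] by force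
  qed (rule new)
  \<comment> \<open>The case \<open>j = 0\<close> gives injectivity, the case of non-zero
    \<open>j\<close> the disjointness of the sample from its translates.\<close>
  have orbit: "iterate f j (g k) = g n \<longleftrightarrow> j = 0 \<and> k = n" for j k n
    using distinct[of k n j] aperiodic[of "g k" j] g by (cases "k = n") auto
  have inj_g: "inj g" using orbit[of 0] by (simp add: inj_def)
  define c where "c = g \<circ> to_nat_on A"
  have "inj_on c A"
    unfolding c_def using assms(2) inj_g by (intro comp_inj_on inj_on_to_nat_on) (auto intro: inj_on_subset)
  moreover have "c a \<in> S a \<inter> H" if "a \<in> A" for a
    using g[of "to_nat_on A a"] that assms(2) by (simp add: c_def e_def)
  moreover have "iterate f j ` c ` A \<inter> c ` A = {}" if "j \<noteq> 0" for j
    using orbit that by (auto simp: c_def)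
  ultimately show ?thesis by blast
qed simp

section \<open>The aperiodic sample\<close>

theorem proposition4p8:
  fixes \<phi> :: "'a::metric_space \<Rightarrow> 'a"
    and br :: "'a \<Rightarrow> 'a \<Rightarrow> 'a"
    and \<epsilon>X lam \<epsilon>X' :: real
    and P Q :: "'a set"
    and \<R> :: "nat \<Rightarrow> 'a set set"
  assumes "smale_space \<phi> br \<epsilon>X lam"
    and "bracket_scale br \<epsilon>X \<epsilon>X'"
    and "irreducible_map \<phi>"
    and "periodic_orbit \<phi> P"
    and "periodic_orbit \<phi> Q"
    and "P \<inter> Q = {}"
    and "refining_markov_sequence \<phi> br \<epsilon>X lam \<epsilon>X' \<R>"
  shows "\<exists>\<G>. aperiodic_sample \<phi> \<R> \<G> \<and> \<G> \<subseteq> heteroclinic_set \<phi> P Q"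
proof -
  interpret smale_space \<phi> br \<epsilon>X lam by (rule assms(1))
  note \<R> = assms(7)[unfolded refining_markov_sequence_def]
  have level0: "\<R> 0 = {UNIV}"
    using \<R> by (rule conjunct1)
  have levels: "finite (\<R> n)" "R \<in> \<R> n \<Longrightarrow> open R \<and> R \<noteq> {}" if "n \<ge> 1" for n R
    using \<R>[THEN conjunct2, THEN conjunct1] \<R>[THEN conjunct2, THEN conjunct2, THEN conjunct1] that
    by (auto simp: proper_finite_cover_def rectangle_def)
  \<comment> \<open>Level 0 is handled apart, since the cover conditions start at level 1.\<close>
  have "finite (\<R> n)" for n using level0 levels(1)[of n] by (cases n) auto
  then have countable: "countable (level_union \<R>)"
    unfolding level_union_def by (intro countable_SIGMA) (auto intro: countable_finite)
  have open_ne: "open (snd a)" "snd a \<noteq> {}" if "a \<in> level_union \<R>" for a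
    using that level0 levels(2)[of "fst a" "snd a"] by (cases "fst a"; force simp: level_union_def)+
  \<comment> \<open>Outside \<open>P\<close>, \<open>stable_set_aperiodic\<close> excludes periodic
    points. The indices are pairs of a level and a set, and \<open>snd\<close> gives the set to be
    sampled, so one set at two levels receives two different points.\<close>
  define H where "H = heteroclinic_set \<phi> P Q - P"
  have "\<exists>c. inj_on c (level_union \<R>) \<and> (\<forall>a\<in>level_union \<R>. c a \<in> snd a \<inter> H) \<and>
      (\<forall>j. j \<noteq> 0 \<longrightarrow> iterate \<phi> j ` c ` level_union \<R> \<inter> c ` level_union \<R> = {})"
  proof (rule choose_points_in_distinct_orbits[OF bij countable])
    show "iterate \<phi> j x \<noteq> x" if "x \<in> H" "j \<noteq> 0" for x j
      using that stable_set_aperiodic[OF bij periodic_orbit_finite periodic_orbit_image] assms(4) bij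
      by (auto simp: H_def heteroclinic_set_def)
    show "\<exists>x \<in> snd a \<inter> H. \<forall>y\<in>F. \<forall>j. iterate \<phi> j y \<noteq> x"
      if "a \<in> level_union \<R>" "finite F" "F \<subseteq> H" for a F
      using heteroclinic_point_avoiding_orbits[OF assms(3-5) open_ne[OF that(1)] that(2)] that(3)
      by (auto simp: H_def)
  qed
  then obtain c where c: "inj_on c (level_union \<R>)" "\<forall>a\<in>level_union \<R>. c a \<in> snd a \<inter> H"
    "\<forall>j. j \<noteq> 0 \<longrightarrow> iterate \<phi> j ` c ` level_union \<R> \<inter> c ` level_union \<R> = {}"
    by (elim exE conjE)
  have "\<forall>(n, R)\<in>level_union \<R>. c (n, R) \<in> R" using c(2) by auto
  with c(1,3) have "aperiodic_sample \<phi> \<R> (c ` level_union \<R>)"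
    unfolding aperiodic_sample_def by blast
  moreover have "c ` level_union \<R> \<subseteq> heteroclinic_set \<phi> P Q"
    using c(2) by (auto simp: H_def)
  ultimately show ?thesis by blast
qed

end
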